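(* Let $n,c\in\mathbb{N}$, let $\mathbf{y}=(c^n)=(c,c,\ldots,c)\in\mathbb{N}^n$, and let $\mathbf{x}=(x_1,x_2,\ldots,x_n)\in[cn]^n$. Then $\mathbf{x}\in\mathsf{PA}^{\mathrm{inv}}_n(\mathbf{y})$ if and only if both of the following hold: (1) $x_i\equiv 1 \pmod c$ for all $i\in[n]$; and (2) $|\{i\in[n]: x_i\le c\cdot j\}|\ge j$ for all $j\in[n]$.
   Context: $\mathbb{N}=\{1,2,3,\ldots\}$ and $[k]=\{1,\ldots,k\}$. Let $\mathbf{y}=(y_1,\ldots,y_n)\in\mathbb{N}^n$ be car lengths and $m=\sum_{i=1}^n y_i$. A one-way street has spots $1,\ldots,m$, initially empty. Given preferences $\mathbf{x}=(x_1,\ldots,x_n)\in[m]^n$, cars $1,\ldots,n$ enter in this order; car $i$ parks in spots $j,j+1,\ldots,j+y_i-1$, where $j\ge x_i$ is the smallest integer such that $j+y_i-1\le m$ and all these spots are unoccupied; if no such $j$ exists, parking fails. If all cars park, $\mathbf{x}$ is a parking assortment for $\mathbf{y}$; $\mathsf{PA}_n(\mathbf{y})$ is the set of these. $\mathsf{PA}^{\mathrm{inv}}_n(\mathbf{y})$ is the set of (permutation) invariant parking assortments: those $\mathbf{x}\in\mathsf{PA}_n(\mathbf{y})$ all of whose rearrangements are also in $\mathsf{PA}_n(\mathbf{y})$ (with $\mathbf{y}$ fixed). *)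

theory Defs
  imports "HOL-Library.Multiset" "HOL-Number_Theory.Cong"
begin

text \<open>
  Cars are listed in order of arrival, so a vector (v_1, ..., v_n) is the list whose entry
  at (0-based) position i - 1 is v_i. Spots keep their 1-based numbers.
\<close>

text \<open>
  On a street with spots 1, ..., m of which those in \<open>occ\<close> are taken, a car of length \<open>l\<close>
  with preference \<open>p\<close> may start at spot \<open>j\<close>.
\<close>

definition can_start :: "nat \<Rightarrow> nat set \<Rightarrow> nat \<Rightarrow> nat \<Rightarrow> nat \<Rightarrow> bool" where
  "can_start m occ p l j \<longleftrightarrow> p \<le> j \<and> j + l - 1 \<le> m \<and> {j..<j + l} \<inter> occ = {}"

text \<open>The queue is a list of pairs (preference, length).\<close>

fun all_park :: "nat \<Rightarrow> nat set \<Rightarrow> (nat \<times> nat) list \<Rightarrow> bool" where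
  "all_park m occ [] \<longleftrightarrow> True"
| "all_park m occ ((p, l) # cars) \<longleftrightarrow>
     (\<exists>j. can_start m occ p l j) \<and>
     (let j = (LEAST j. can_start m occ p l j) in all_park m (occ \<union> {j..<j + l}) cars)"

definition PA :: "nat list \<Rightarrow> nat list set" where
  "PA y = {x. length x = length y \<and> set x \<subseteq> {1..sum_list y} \<and>
              all_park (sum_list y) {} (zip x y)}"

definition PA_inv :: "nat list \<Rightarrow> nat list set" where
  "PA_inv y = {x \<in> PA y. \<forall>x'. mset x' = mset x \<longrightarrow> x' \<in> PA y}"

end

theory Submission imports Defs begin

text \<open>
  Since the total length of the cars is the length of the street, cars of length \<open>c\<close> that all
  park must tile it, so their starting spots are \<open>1, c + 1, \<dots>, (n - 1) c + 1\<close>. Each of the cars in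
  the first \<open>j\<close> tiles prefers a spot at most \<open>c j\<close>, which is (2). The first car of the queue starts
  exactly at its preference; as every car can be moved to the front, this is (1). Conversely, if
  all preferences are congruent to 1, the parking process runs in whole blocks of \<open>c\<close> spots and is
  that of classical parking functions.
\<close>

section \<open>Starting spots of the parked cars\<close>

text \<open>\<open>sorted_wrt\<close> compares each entry with all later ones, so this is pairwise
  disjointness; no ordering of the starts is meant.\<close>

definition disjoint_starts :: "nat \<Rightarrow> nat list \<Rightarrow> bool" where
  "disjoint_starts c = sorted_wrt (\<lambda>s t. {s..<s + c} \<inter> {t..<t + c} = {})"

text \<open>The witness collects the spots chosen by \<open>LEAST\<close>. Later cars park with the
  head's interval added to \<open>occ\<close>, which gives disjointness. Only the head keeps its
  exact choice, because only the first car has to be located precisely later.\<close>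

lemma all_park_starts:
  assumes "all_park m occ (zip x (replicate (length x) c))"
  shows "\<exists>s. list_all2 (\<lambda>p t. p \<le> t \<and> t + c - 1 \<le> m \<and> {t..<t + c} \<inter> occ = {}) x s
    \<and> disjoint_starts c s
    \<and> (x \<noteq> [] \<longrightarrow> hd s = (LEAST j. can_start m occ (hd x) c j))"
  using assms
proof (induction x arbitrary: occ)
  case Nil
  then show ?case by (simp add: disjoint_starts_def)
next
  case (Cons p x)
  define j where "j = (LEAST j. can_start m occ p c j)"
  have ex: "\<exists>j. can_start m occ p c j"
    and rest: "all_park m (occ \<union> {j..<j + c}) (zip x (replicate (length x) c))"
    using Cons.prems by (auto simp: j_def Let_def)
  have j: "can_start m occ p c j"
    unfolding j_def using ex by (rule LeastI_ex)
  obtain s where s: "list_all2 (\<lambda>p t. p \<le> t \<and> t + c - 1 \<le> m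
        \<and> {t..<t + c} \<inter> (occ \<union> {j..<j + c}) = {}) x s" and d: "disjoint_starts c s"
    using Cons.IH[OF rest] by blast
  have "\<forall>t\<in>set s. {j..<j + c} \<inter> {t..<t + c} = {}"
  proof
    fix t assume "t \<in> set s"
    then obtain i where "i < length s" "t = s ! i" by (metis in_set_conv_nth)
    then have "{t..<t + c} \<inter> (occ \<union> {j..<j + c}) = {}"
      using list_all2_nthD2[OF s] by blast
    then show "{j..<j + c} \<inter> {t..<t + c} = {}" by blast
  qed
  moreover have "list_all2 (\<lambda>p t. p \<le> t \<and> t + c - 1 \<le> m \<and> {t..<t + c} \<inter> occ = {}) x s"
    using s by (rule list_all2_mono) blast
  ultimately show ?case
    using j d by (intro exI[of _ "j # s"]) (simp add: can_start_def disjoint_starts_def j_def)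
qed

lemma disjoint_starts_distinct:
  assumes "c \<ge> 1" and "disjoint_starts c s"
  shows "distinct s"
  using assms(2) unfolding disjoint_starts_def
proof (induction s)
  case (Cons a s)
  then show ?case using assms(1) by fastforce
qed simp

lemma disjoint_starts_sep:
  assumes "disjoint_starts c s" and "a \<in> set s" "b \<in> set s" "a < b"
  shows "a + c \<le> b"
  using assms unfolding disjoint_starts_def
proof (induction s)
  case (Cons e s)
  have *: "a + c \<le> b" if "{a..<a + c} \<inter> {b..<b + c} = {}"
  proof (rule ccontr)
    assume "\<not> a + c \<le> b"
    then have "b \<in> {a..<a + c} \<inter> {b..<b + c}" using \<open>a < b\<close> by auto
    then show False using that by blast
  qed
  from Cons.prems consider "a = e" "b \<in> set s" | "b = e" "a \<in> set s" | "a \<in> set s" "b \<in> set s"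
    by auto
  then show ?case
    by cases (use Cons * in \<open>auto simp: Int_commute\<close>)
qed simp

text \<open>
  Pigeonhole: each block contains one starting spot, and comparing neighbours from the last block
  downwards forces it to be the first spot of its block.
\<close>

lemma tiling_starts:
  fixes S :: "nat set"
  assumes c: "c \<ge> 1" and S: "S \<subseteq> {1..}" "\<And>t. t \<in> S \<Longrightarrow> t + c - 1 \<le> c * n"
    and sep: "\<And>a b. a \<in> S \<Longrightarrow> b \<in> S \<Longrightarrow> a < b \<Longrightarrow> a + c \<le> b"
    and card: "card S = n"
  shows "S = (\<lambda>q. c * q + 1) ` {..<n}"
proof -
  define f where "f t = (t - 1) div c" for t
  have bounds: "c * f t + 1 \<le> t \<and> t \<le> c * f t + c" if "t \<in> S" for t
  proof -
    have "t \<ge> 1" using that S by auto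
    moreover have "c * f t + (t - 1) mod c = t - 1" by (simp add: f_def)
    moreover have "(t - 1) mod c < c" using c by simp
    ultimately show ?thesis by linarith
  qed
  \<comment> \<open>Two starts in the same block would be less than \<open>c\<close> apart.\<close>
  have inj: "inj_on f S"
  proof (rule inj_onI, rule ccontr)
    fix a b assume "a \<in> S" "b \<in> S" "f a = f b" "a \<noteq> b"
    then show False
      using bounds[of a] bounds[of b] sep[of a b] sep[of b a] by (cases "a < b") auto
  qed
  have sub: "f ` S \<subseteq> {..<n}"
  proof
    fix q assume "q \<in> f ` S"
    then obtain t where t: "t \<in> S" "q = f t" by blast
    have "c * q < c * n"
      using bounds[OF t(1)] S(2)[OF t(1)] c unfolding t(2) by linarith
    then show "q \<in> {..<n}" by simp
  qed
  have im: "f ` S = {..<n}"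
    using sub inj card by (simp add: card_image card_subset_eq)
  have first: "c * q + 1 \<in> S" if "q < n" for q
  proof -
    have "q \<le> n - 1" using that by simp
    then show ?thesis
    proof (induction rule: inc_induct)
      case base
      \<comment> \<open>In the last block any later start would run past \<open>c * n\<close>; this
        anchors the downward induction.\<close>
      have "n - 1 \<in> f ` S" using im that by auto
      then obtain t where t: "t \<in> S" "f t = n - 1" by auto
      have "c * n = c * (n - 1) + c" using that by (cases n) auto
      then have "t = c * (n - 1) + 1"
        using bounds[OF t(1)] S(2)[OF t(1)] c unfolding t(2) by linarith
      then show ?case using t by simp
    next
      case (step k)
      have "k \<in> f ` S" using im step.hyps that by auto
      then obtain t where t: "t \<in> S" "f t = k" by auto
      \<comment> \<open>Block \<open>k + 1\<close> is already known to be started at its first spot,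
        so separation leaves only the first spot of block \<open>k\<close>.\<close>
      have "t < c * Suc k + 1" using bounds[OF t(1)] t(2) by simp
      then have "t + c \<le> c * Suc k + 1" using sep[OF t(1) step.IH] by simp
      then have "t = c * k + 1" using bounds[OF t(1)] t(2) by simp
      then show ?case using t by simp
    qed
  qed
  have "(\<lambda>q. c * q + 1) ` {..<n} \<subseteq> S" using first by auto
  moreover have "card ((\<lambda>q. c * q + 1) ` {..<n}) = n"
    using c by (subst card_image) (auto simp: inj_on_def)
  \<comment> \<open>For \<open>n = 0\<close> the equation \<open>card S = n\<close> does not give
    finiteness; it is pulled back along \<open>f\<close>.\<close>
  moreover have "finite S" using inj im by (metis finite_imageD finite_lessThan)
  ultimately show ?thesis using card by (metis card_subset_eq)
qed

lemma PA_replicate_starts: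
  assumes c: "c \<ge> 1" and x: "x \<in> PA (replicate n c)"
  obtains s where "list_all2 (\<le>) x s" "distinct s" "set s = (\<lambda>q. c * q + 1) ` {..<n}"
    and "x \<noteq> [] \<Longrightarrow> hd s = hd x"
proof -
  have len: "length x = n" and range: "set x \<subseteq> {1..c * n}"
    and park: "all_park (c * n) {} (zip x (replicate (length x) c))"
    using x by (auto simp: PA_def sum_list_replicate mult.commute)
  obtain s where s: "list_all2 (\<lambda>p t. p \<le> t \<and> t + c - 1 \<le> c * n \<and> {t..<t + c} \<inter> {} = {}) x s"
    and d: "disjoint_starts c s"
    and hd: "x \<noteq> [] \<longrightarrow> hd s = (LEAST j. can_start (c * n) {} (hd x) c j)"
    using all_park_starts[OF park] by blast
  have le: "list_all2 (\<le>) x s" using s by (rule list_all2_mono) simp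
  have len_s: "length s = n" using s len by (auto dest: list_all2_lengthD)
  have dist: "distinct s" using disjoint_starts_distinct[OF c d] .
  have elem: "1 \<le> t \<and> t + c - 1 \<le> c * n" if "t \<in> set s" for t
  proof -
    obtain i where i: "i < length s" "t = s ! i"
      using \<open>t \<in> set s\<close> by (auto simp: in_set_conv_nth)
    have "x ! i \<le> t" "t + c - 1 \<le> c * n" using list_all2_nthD2[OF s i(1)] i(2) by simp_all
    moreover have "x ! i \<in> set x" using i(1) len len_s by simp
    then have "x ! i \<ge> 1" using range by auto
    ultimately show ?thesis by simp
  qed
  have "set s = (\<lambda>q. c * q + 1) ` {..<n}"
    using elem disjoint_starts_sep[OF d] distinct_card[OF dist] len_s
    by (intro tiling_starts c) auto
  moreover have "hd s = hd x" if "x \<noteq> []"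
  proof -
    \<comment> \<open>The first car finds an empty street, and its preference leaves room for its
      length since its actual start, which is no earlier, does.\<close>
    have "hd s + c - 1 \<le> c * n" "hd x \<le> hd s"
      using elem[of "hd s"] s that by (cases x; auto simp: list_all2_Cons1)+
    then have "(LEAST j. can_start (c * n) {} (hd x) c j) = hd x"
      by (intro Least_equality) (auto simp: can_start_def)
    then show ?thesis using hd that by simp
  qed
  ultimately show ?thesis using that le dist by blast
qed

section \<open>Necessity of the two conditions\<close>

lemma PA_replicate_count:
  assumes c: "c \<ge> 1" and x: "x \<in> PA (replicate n c)" and j: "j \<le> n"
  shows "j \<le> card {i. i < n \<and> x ! i \<le> c * j}"
proof -
  obtain s where le: "list_all2 (\<le>) x s" and dist: "distinct s"
    and set: "set s = (\<lambda>q. c * q + 1) ` {..<n}"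
    using PA_replicate_starts[OF c x] .
  have len: "length s = n" using le x by (auto simp: PA_def dest: list_all2_lengthD)
  \<comment> \<open>Each of the first \<open>j\<close> tiles is started by a car that prefers its
    own start or an earlier spot; counting these cars through their starts gives the bound.\<close>
  have "(\<lambda>q. c * q + 1) ` {..<j} \<subseteq> (!) s ` {i. i < n \<and> x ! i \<le> c * j}"
  proof
    fix t assume "t \<in> (\<lambda>q. c * q + 1) ` {..<j}"
    then obtain q where q: "q < j" "t = c * q + 1" by auto
    then have "t \<in> set s" using set j by auto
    then obtain i where i: "i < n" "s ! i = t" using len by (metis in_set_conv_nth)
    have "c * Suc q \<le> c * j" using q by (intro mult_left_mono) auto
    then have "t \<le> c * j" using q c by simp
    then have "x ! i \<le> c * j" using list_all2_nthD2[OF le, of i] i len by simp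
    then show "t \<in> (!) s ` {i. i < n \<and> x ! i \<le> c * j}" using i by blast
  qed
  then have "card ((\<lambda>q. c * q + 1) ` {..<j}) \<le> card {i. i < n \<and> x ! i \<le> c * j}"
    by (intro surj_card_le) auto
  moreover have "card ((\<lambda>q. c * q + 1) ` {..<j}) = j"
    using c by (subst card_image) (auto simp: inj_on_def)
  ultimately show ?thesis by simp
qed

text \<open>Invariance is used only for the rearrangement that moves \<open>p\<close> to the front:
  that car starts exactly at \<open>p\<close>, so \<open>p\<close> begins a tile.\<close>

lemma PA_inv_replicate_cong:
  assumes c: "c \<ge> 1" and x: "x \<in> PA_inv (replicate n c)" and p: "p \<in> set x"
  shows "[p = 1] (mod c)"
proof -
  have "mset (p # remove1 p x) = mset x" using p by simp
  then have "p # remove1 p x \<in> PA (replicate n c)" using x unfolding PA_inv_def by blast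
  then obtain s where s: "list_all2 (\<le>) (p # remove1 p x) s"
      "set s = (\<lambda>q. c * q + 1) ` {..<n}" "hd s = p"
    using PA_replicate_starts[OF c] by (metis list.distinct(1) list.sel(1))
  then have "p \<in> (\<lambda>q. c * q + 1) ` {..<n}" by (cases s) auto
  then obtain q where "p = 1 + c * q" by auto
  then show ?thesis unfolding cong_def by (simp only: mod_mult_self2)
qed

section \<open>Sufficiency: parking by whole blocks\<close>

text \<open>Reduces one parking step to classical parking on blocks numbered from 0. Minimality
  holds because the first spot of any admissible interval is free, so its whole block is free and
  cannot precede block \<open>b\<close>.\<close>

lemma first_free_block_start:
  assumes c: "c \<ge> 1" and b: "a \<le> b" "b < n" "b \<notin> B"
    and least: "\<And>q. a \<le> q \<Longrightarrow> q < n \<Longrightarrow> q \<notin> B \<Longrightarrow> b \<le> q"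
  defines "occ \<equiv> (\<Union>q\<in>B. {c * q + 1..<c * q + 1 + c})"
  shows "can_start (c * n) occ (c * a + 1) c (c * b + 1)"
    and "(LEAST j. can_start (c * n) occ (c * a + 1) c j) = c * b + 1"
proof -
  \<comment> \<open>The condition \<open>v \<ge> 1\<close> matters: truncated subtraction would
    place spot 0 in block 0.\<close>
  have occ_iff: "v \<in> occ \<longleftrightarrow> v \<ge> 1 \<and> (v - 1) div c \<in> B" for v
  proof -
    have "v \<in> {c * q + 1..<c * q + 1 + c} \<longleftrightarrow> v \<ge> 1 \<and> (v - 1) div c = q" for q
    proof (cases v)
      case (Suc w)
      have "c * q \<le> w \<and> w < c * q + c \<longleftrightarrow> w div c = q"
        using c by (metis add.commute div_nat_eqI dividend_less_times_div less_eq_Suc_le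
            mult.commute mult_Suc times_div_less_eq_dividend One_nat_def)
      then show ?thesis using Suc by auto
    qed simp
    then show ?thesis unfolding occ_def UN_iff by simp
  qed
  have "c * Suc b \<le> c * n" using b by (intro mult_left_mono) auto
  moreover have "{c * b + 1..<c * b + 1 + c} \<inter> occ = {}"
  proof -
    have "(v - 1) div c = b" if "v \<in> {c * b + 1..<c * b + 1 + c}" for v
      using that by (intro div_nat_eqI) (auto simp: mult.commute)
    then show ?thesis using b occ_iff by auto
  qed
  ultimately show start: "can_start (c * n) occ (c * a + 1) c (c * b + 1)"
    using b c unfolding can_start_def by auto
  show "(LEAST j. can_start (c * n) occ (c * a + 1) c j) = c * b + 1"
  proof (rule Least_equality[where P = "can_start (c * n) occ (c * a + 1) c", OF start])
    fix j assume j: "can_start (c * n) occ (c * a + 1) c j"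
    define q where "q = (j - 1) div c"
    have "j \<in> {j..<j + c}" using c by simp
    then have "j \<notin> occ" and ge: "c * a + 1 \<le> j" and le: "j + c - 1 \<le> c * n"
      using j unfolding can_start_def by blast+
    then have "q \<notin> B" using occ_iff[of j] q_def by simp
    moreover have "a \<le> q" using ge c by (simp add: q_def less_eq_div_iff_mult_less_eq mult.commute)
    moreover have "q < n"
      using le ge c by (simp add: q_def div_less_iff_less_mult mult.commute)
    ultimately have "c * b \<le> c * q" using least by simp
    also have "c * q \<le> j - 1" by (simp add: q_def)
    finally show "c * b + 1 \<le> j" using ge by simp
  qed
qed

text \<open>
  The Hall-type hypothesis, stated for an arbitrary set \<open>B\<close> of occupied blocks so that it can
  serve as the invariant of the parking process.
\<close>

lemma all_park_blocks:
  assumes c: "c \<ge> 1"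
    and "\<And>t. length (filter (\<lambda>a. t \<le> a) as) \<le> card ({t..<n} - B)"
  shows "all_park (c * n) (\<Union>b\<in>B. {c * b + 1..<c * b + 1 + c})
    (zip (map (\<lambda>a. c * a + 1) as) (replicate (length as) c))"
  using assms(2)
proof (induction as arbitrary: B)
  case (Cons a as)
  \<comment> \<open>The head itself is counted at threshold \<open>a\<close>, so some block from
    \<open>a\<close> on is free.\<close>
  have "0 < length (filter (\<lambda>e. a \<le> e) (a # as))" by simp
  then have "card ({a..<n} - B) > 0" using Cons.prems[of a] by (rule less_le_trans)
  then have ex: "\<exists>q. q \<in> {a..<n} - B" by (metis card.empty ex_in_conv less_irrefl)
  define b where "b = (LEAST q. q \<in> {a..<n} - B)"
  have b: "b \<in> {a..<n} - B" unfolding b_def using ex by (rule LeastI_ex)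
  have least: "b \<le> q" if "q \<in> {a..<n} - B" for q
    unfolding b_def using that by (rule Least_le)
  have "length (filter (\<lambda>a. t \<le> a) as) \<le> card ({t..<n} - insert b B)" for t
  proof -
    have remove: "card ({t..<n} - insert b B) = card ({t..<n} - B) - 1" if "t \<le> b"
    proof -
      have "{t..<n} - insert b B = {t..<n} - B - {b}" by blast
      then show ?thesis using b that by (simp only:) (simp add: card_Diff_singleton)
    qed
    \<comment> \<open>For \<open>t \<le> a\<close> both sides lose one. For
      \<open>a < t \<le> b\<close> no free block lies between \<open>a\<close> and \<open>t\<close>,
      so the bound at \<open>a\<close>, which also counts the parked car, applies. Beyond
      \<open>b\<close> no block is lost.\<close>
    consider "t \<le> a" | "a < t" "t \<le> b" | "b < t" by linarith
    then show ?thesis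
    proof cases
      case 1
      then show ?thesis using remove Cons.prems[of t] b by simp
    next
      case 2
      have "{t..<n} - B = {a..<n} - B"
        using least 2 by force
      moreover have "length (filter (\<lambda>e. t \<le> e) as) \<le> length (filter (\<lambda>e. a \<le> e) as)"
        using 2 by (induction as) auto
      ultimately show ?thesis using remove 2 Cons.prems[of a] by simp
    next
      case 3
      then have "{t..<n} - insert b B = {t..<n} - B" by auto
      moreover have "length (filter (\<lambda>e. t \<le> e) as) \<le> length (filter (\<lambda>e. t \<le> e) (a # as))"
        by simp
      ultimately show ?thesis using Cons.prems[of t] by simp
    qed
  qed
  then have "all_park (c * n) (\<Union>q\<in>insert b B. {c * q + 1..<c * q + 1 + c})
      (zip (map (\<lambda>a. c * a + 1) as) (replicate (length as) c))"
    by (rule Cons.IH)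
  moreover note first_free_block_start[OF c, of a b n B]
  ultimately show ?case
    using b least by (auto simp: Let_def Un_commute)
qed simp

text \<open>Complementary counting turns \<open>count\<close> into the Hall-type bound: if
  \<open>t\<close> cars prefer spots up to \<open>c * t\<close>, at most \<open>n - t\<close> cars
  prefer block \<open>t\<close> or later, and there are \<open>n - t\<close> such blocks.\<close>

lemma PA_replicateI:
  assumes c: "c \<ge> 1" and len: "length x = n" and range: "set x \<subseteq> {1..c * n}"
    and cong: "\<forall>p\<in>set x. [p = 1] (mod c)"
    and count: "\<And>j. j \<in> {1..n} \<Longrightarrow> j \<le> length (filter (\<lambda>p. p \<le> c * j) x)"
  shows "x \<in> PA (replicate n c)"
proof -
  define as where "as = map (\<lambda>p. (p - 1) div c) x"
  have dvd: "c dvd p - 1" if "p \<in> set x" for p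
    using that range cong by (subst cong_to_1_nat) auto
  have x: "x = map (\<lambda>a. c * a + 1) as"
    unfolding as_def map_map using dvd range by (intro map_idI[symmetric]) force
  have "length (filter (\<lambda>a. t \<le> a) as) \<le> card ({t..<n} - {})" for t
  proof -
    have iff: "t \<le> (p - 1) div c \<longleftrightarrow> \<not> p \<le> c * t" if "p \<in> set x" for p
    proof -
      have "p \<ge> 1" using that range by auto
      then show ?thesis using c by (auto simp: less_eq_div_iff_mult_less_eq mult.commute)
    qed
    have "length (filter (\<lambda>a. t \<le> a) as) = length (filter (\<lambda>p. \<not> p \<le> c * t) x)"
      using iff by (simp add: as_def filter_map comp_def cong: filter_cong)
    also have "\<dots> = n - length (filter (\<lambda>p. p \<le> c * t) x)"
      using sum_length_filter_compl[of "\<lambda>p. p \<le> c * t" x] len by simp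
    also have "\<dots> \<le> n - t"
    proof (cases "t \<in> {1..n}")
      case True
      then show ?thesis using count[of t] by simp
    next
      \<comment> \<open>Outside the range of \<open>count\<close>: for \<open>t = 0\<close> the
        bound is trivial, and for \<open>t > n\<close> every preference is at most
        \<open>c * t\<close>.\<close>
      case False
      have "n - length (filter (\<lambda>p. p \<le> c * t) x) = 0" if "t > n"
      proof -
        have "c * n \<le> c * t" using that by simp
        have "p \<le> c * t" if "p \<in> set x" for p
          using that range by (intro order.trans[OF _ \<open>c * n \<le> c * t\<close>]) auto
        then have "filter (\<lambda>p. p \<le> c * t) x = x" by simp
        then show ?thesis using len by simp
      qed
      then show ?thesis using False by (cases "t > n") auto
    qed
    finally show ?thesis by simp
  qed
  then have "all_park (c * n) {} (zip x (replicate (length as) c))"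
    using all_park_blocks[OF c, of as n "{}"] x by simp
  then show ?thesis
    using len range by (simp add: PA_def as_def sum_list_replicate mult.commute)
qed

theorem theorem3p1:
  fixes n c :: nat and x :: "nat list"
  assumes "n \<ge> 1" and "c \<ge> 1"
    and "length x = n" and "set x \<subseteq> {1..c * n}"
  shows "x \<in> PA_inv (replicate n c) \<longleftrightarrow>
    (\<forall>i<n. [x ! i = 1] (mod c)) \<and>
    (\<forall>j\<in>{1..n}. card {i. i < n \<and> x ! i \<le> c * j} \<ge> j)"
proof (intro iffI conjI ballI allI impI)
  fix i assume "x \<in> PA_inv (replicate n c)" "i < n"
  then show "[x ! i = 1] (mod c)"
    using assms by (intro PA_inv_replicate_cong) auto
next
  fix j assume "x \<in> PA_inv (replicate n c)" "j \<in> {1..n}"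
  then show "card {i. i < n \<and> x ! i \<le> c * j} \<ge> j"
    using assms by (intro PA_replicate_count) (auto simp: PA_inv_def)
next
  assume *: "(\<forall>i<n. [x ! i = 1] (mod c)) \<and>
    (\<forall>j\<in>{1..n}. card {i. i < n \<and> x ! i \<le> c * j} \<ge> j)"
  \<comment> \<open>Both conditions depend only on the multiset of preferences, so they pass to
    every rearrangement; the index count is rewritten as a \<open>filter\<close> length to make this
    visible.\<close>
  have "x' \<in> PA (replicate n c)" if perm: "mset x' = mset x" for x'
  proof (rule PA_replicateI[OF assms(2)])
    have set: "set x' = set x" using perm by (rule mset_eq_setD)
    show "length x' = n" using perm assms(3) by (metis size_mset)
    show "set x' \<subseteq> {1..c * n}" using set assms(4) by simp
    show "\<forall>p\<in>set x'. [p = 1] (mod c)" using set * assms(3) by (metis in_set_conv_nth)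
    fix j assume "j \<in> {1..n}"
    then have "j \<le> length (filter (\<lambda>p. p \<le> c * j) x)"
      using * assms(3) by (simp add: length_filter_conv_card)
    also have "\<dots> = length (filter (\<lambda>p. p \<le> c * j) x')"
      using perm by (metis mset_filter size_mset)
    finally show "j \<le> length (filter (\<lambda>p. p \<le> c * j) x')" .
  qed
  then show "x \<in> PA_inv (replicate n c)" unfolding PA_inv_def by blast
qed

end
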